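(* Let $G$ be a finite simple graph whose complement is a set of independent edges (i.e. the edges of the complement of $G$ are pairwise disjoint). Then $G$ is good.
   Context: $\mu$ is Lebesgue measure on $[0,1]$. $\mathcal{H}$ is the space of bounded measurable real functions on $[0,1]^2$. A bounded measurable nonnegative symmetric function $g$ on $[0,1]^2$ is called doubly nonnegative if there is $h\in\mathcal{H}$ (possibly taking negative values) with $g(x,y)=\int_{[0,1]}h(x,z)h(y,z)\,d\mu(z)$ for (almost) all $x,y$. For a finite simple graph $G$ with vertices $v_1,\dots,v_n$ and edge set $E(G)$, $t(G,g)=\int_{[0,1]^n}\prod_{\{v_i,v_j\}\in E(G)}g(x_i,x_j)\,d\mu^n$. A finite simple graph $G$ is called good if $t(G,g)\ge\left(\int_{[0,1]^2}g\,d\mu^2\right)^{|E(G)|}$ for every doubly nonnegative function $g$. *)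

theory Defs
  imports "HOL-Analysis.Analysis"
begin

text \<open>
  A graph is given by its vertex set \<open>V\<close> and its edge set \<open>E\<close>, whose members are
  two-element subsets of \<open>V\<close>.
\<close>

definition vertex_pairs :: "'a set \<Rightarrow> 'a set set" where
  "vertex_pairs V = {e. e \<subseteq> V \<and> card e = 2}"

definition finite_simple_graph :: "'a set \<Rightarrow> 'a set set \<Rightarrow> bool" where
  "finite_simple_graph V E \<longleftrightarrow> finite V \<and> E \<subseteq> vertex_pairs V"

definition complement_edges :: "'a set \<Rightarrow> 'a set set \<Rightarrow> 'a set set" where
  "complement_edges V E = vertex_pairs V - E"

definition independent_edges :: "'a set set \<Rightarrow> bool" where
  "independent_edges F \<longleftrightarrow> pairwise disjnt F"

abbreviation lebesgue01 :: "real measure" where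
  "lebesgue01 \<equiv> lebesgue_on {0..1}"

abbreviation lebesgue01_square :: "(real \<times> real) measure" where
  "lebesgue01_square \<equiv> lebesgue_on ({0..1} \<times> {0..1})"

text \<open>
  Functions on the unit square are total functions on \<open>real \<times> real\<close> whose values outside the
  unit square are irrelevant. Measurability is Lebesgue measurability.
\<close>

definition bounded_measurable :: "(real \<times> real \<Rightarrow> real) \<Rightarrow> bool" where
  "bounded_measurable h \<longleftrightarrow>
     h \<in> borel_measurable lebesgue01_square \<and> bounded (h ` ({0..1} \<times> {0..1}))"

text \<open>
  Only almost every slice \<open>h (x, _)\<close> of a Lebesgue measurable \<open>h\<close> is measurable, so the
  representation can only be demanded almost everywhere.
\<close>

definition doubly_nonnegative :: "(real \<times> real \<Rightarrow> real) \<Rightarrow> bool" where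
  "doubly_nonnegative g \<longleftrightarrow>
     bounded_measurable g \<and>
     (\<forall>x\<in>{0..1}. \<forall>y\<in>{0..1}. 0 \<le> g (x, y)) \<and>
     (\<forall>x\<in>{0..1}. \<forall>y\<in>{0..1}. g (x, y) = g (y, x)) \<and>
     (\<exists>h. bounded_measurable h \<and>
        (AE (x, y) in lebesgue01_square. g (x, y) = (LINT z|lebesgue01. h (x, z) * h (y, z))))"

text \<open>
  The factor \<open>g (x u, x v)\<close> belonging to an unordered edge \<open>{u, v}\<close>. It does not depend on the
  order of the endpoints when \<open>g\<close> is symmetric on the unit square and \<open>x\<close> takes values in
  the unit interval.
\<close>

definition edge_factor :: "(real \<times> real \<Rightarrow> real) \<Rightarrow> ('a \<Rightarrow> real) \<Rightarrow> 'a set \<Rightarrow> real" where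
  "edge_factor g x e = (THE r. \<exists>u v. e = {u, v} \<and> r = g (x u, x v))"

lemma edge_factor_doubleton:
  assumes "g (x u, x v) = g (x v, x u)"
  shows "edge_factor g x {u, v} = g (x u, x v)"
  unfolding edge_factor_def
proof (rule the_equality)
  show "\<exists>u' v'. {u, v} = {u', v'} \<and> g (x u, x v) = g (x u', x v')"
    by blast
next
  fix r assume "\<exists>u' v'. {u, v} = {u', v'} \<and> r = g (x u', x v')"
  then show "r = g (x u, x v)"
    using assms by (auto simp: doubleton_eq_iff)
qed

text \<open>
  The completion turns the finite product of copies of Lebesgue measure on the unit interval
  (which is not complete) into Lebesgue measure on the cube of functions from \<open>V\<close> to the unit
  interval; the integrand is in general measurable only for the completed measure.
\<close>

definition graph_density :: "'a set \<Rightarrow> 'a set set \<Rightarrow> (real \<times> real \<Rightarrow> real) \<Rightarrow> real" where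
  "graph_density V E g =
     (LINT x|completion (PiM V (\<lambda>_. lebesgue01)). (\<Prod>e\<in>E. edge_factor g x e))"

definition good_graph :: "'a set \<Rightarrow> 'a set set \<Rightarrow> bool" where
  "good_graph V E \<longleftrightarrow>
     (\<forall>g. doubly_nonnegative g \<longrightarrow>
        graph_density V E g \<ge> (LINT p|lebesgue01_square. g p) ^ card E)"

end

theory Submission
  imports Defs "HOL-Probability.Infinite_Product_Measure"
begin

text \<open>
  Up to null sets, a doubly nonnegative function is a bounded symmetric kernel \<open>k \<ge> 0\<close> that is
  positive semidefinite as a quadratic form. Passing from \<open>k(x,y)\<close> to \<open>w(x) k(x,y) w(y)\<close> preserves
  this, so a nonnegative weight \<open>w\<close> may be attached to every vertex, and the natural statement to
  prove by induction is the weighted and homogeneous one (\<open>weighted_good\<close>): with \<open>I = \<integral>w\<close> and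
  \<open>P = \<integral>\<integral>k(x,y) w(x) w(y)\<close>, the weighted density of a graph with \<open>N\<close> vertices and \<open>e\<close> edges is
  at least \<open>I^N (P / I\<^sup>2)^e\<close>.

  A graph whose complement is a matching is complete multipartite with parts of size one or two.
  It can therefore be built by starting from one part and repeatedly joining the graph \<open>G'\<close>
  obtained so far to a new independent set \<open>S\<close>. Fix the position \<open>z\<close> of the vertices of \<open>S\<close>. The
  rest is the density of \<open>G'\<close> for the new weight \<open>W(x) = w(x) \<Prod>k(x,z\<^sub>s)\<close>, to which the
  induction hypothesis applies. Its edge term \<open>\<integral>\<integral>k W W\<close> is at least \<open>q\<^sup>2 / P\<close>, where
  \<open>q(z) = \<integral>W(x) d(x)\<close> and \<open>d(x) = \<integral>k(x,y) w(y)\<close>, by the Cauchy-Schwarz inequality for the form of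
  \<open>k\<close>; this is the only use of positive semidefiniteness. So, up to powers of \<open>P\<close>, the density of
  \<open>G'\<close> is at least \<open>q^A c^(N-A)\<close> with \<open>c(z) = \<integral>W\<close> and \<open>A = 2e\<close>. When \<open>A \<ge> N\<close> or \<open>A = 0\<close> this is a
  convex function of \<open>(c, q)\<close>, and Jensen's inequality reduces the claim to the means of \<open>c\<close> and
  \<open>q\<close> over \<open>z\<close>. By Fubini these are \<open>\<integral>w d^s\<close> and \<open>\<integral>w d^(s+1)\<close> up to powers of \<open>I\<close>, where
  \<open>s = |S|\<close>, and comparing these moments of \<open>d\<close> with powers of \<open>P / I\<close> finishes the induction
  step (\<open>weighted_good_join\<close>).

  What remains is measure theory: replacing the given function by a Borel measurable kernel
  that agrees with it almost everywhere, and checking that neither the double integral nor the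
  density changes (\<open>doubly_nonnegative_kernel\<close>, \<open>graph_density_AE_eq\<close>).
\<close>

section \<open>A tangent plane inequality\<close>

text \<open>
  Under the condition on \<open>A\<close>, the function \<open>a^(N-A) b^A\<close> of positive \<open>a\<close>, \<open>b\<close> is convex and lies above
  its tangent plane at \<open>(1, 1)\<close>. Using the tangent plane instead of Jensen's inequality leaves only
  linear terms to be integrated.
  Clearing the denominator \<open>a^(A-N)\<close> makes the statement cover \<open>a = 0\<close>. For positive arguments it
  is the weighted inequality of arithmetic and geometric means for \<open>t\<close>, \<open>a\<close> and \<open>1\<close> with
  multiplicities \<open>1\<close>, \<open>A - N\<close> and \<open>N - 1\<close>; for \<open>A = 0\<close> it is Bernoulli's inequality.
\<close>

lemma tangent_plane_bound:
  fixes t a b :: real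
  assumes "0 \<le> t" "0 \<le> a" "0 \<le> b"
    and le: "a ^ N * b ^ A \<le> t * a ^ A"
    and N: "1 \<le> N" and A: "A = 0 \<or> N \<le> A" and zero: "a = 0 \<Longrightarrow> b = 0"
  shows "1 + real A * (b - 1) + (real N - real A) * (a - 1) \<le> t"
proof -
  consider "a = 0" | "A = 0" | "a > 0" "N \<le> A" "b = 0" | "a > 0" "b > 0" "N \<le> A"
    using assms by force
  then show ?thesis
  proof cases
    case 1
    then show ?thesis using zero N \<open>0 \<le> t\<close> by (simp add: algebra_simps)
  next
    case 2
    have "1 + real N * (a - 1) \<le> (1 + (a - 1)) ^ N"
      using \<open>0 \<le> a\<close> by (intro Bernoulli_inequality) auto
    then show ?thesis using 2 le by simp
  next
    case 3
    have "a * real N \<le> a * real A"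
      using 3 by (intro mult_left_mono) auto
    moreover have "1 \<le> real N" using N by simp
    moreover have "1 + real A * (b - 1) + (real N - real A) * (a - 1)
        = 1 - real N + (a * real N - a * real A)"
      using 3 by (simp add: algebra_simps)
    ultimately show ?thesis using \<open>0 \<le> t\<close> by linarith
  next
    case 4
    then have pos: "0 < a ^ N * b ^ A" by simp
    with le have "0 < t * a ^ A" by linarith
    then have t: "0 < t" using 4 by (simp add: zero_less_mult_iff)
    have "ln (a ^ N * b ^ A) \<le> ln (t * a ^ A)"
      using pos le by simp
    then have ln: "real N * ln a + real A * ln b \<le> ln t + real A * ln a"
      using 4 t by (simp add: ln_mult ln_realpow)
    \<comment> \<open>The tangent to the exponential function at \<open>ln b\<close>; summing it over the factors
        gives the mean inequality.\<close>
    have young: "b * (1 + ln y - ln b) \<le> y" if "0 < y" for y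
    proof -
      have "ln (y / b) \<le> y / b - 1" using that 4 by (intro ln_le_minus_one) simp
      then have "b * (1 + ln (y / b)) \<le> b * (y / b)"
        using 4 by (intro mult_left_mono) auto
      then show ?thesis using that 4 by (simp add: ln_div algebra_simps)
    qed
    have "(real A - real N) * (b * (1 + ln a - ln b)) \<le> (real A - real N) * a"
      using 4 by (intro mult_left_mono young) auto
    moreover have "(real N - 1) * (b * (1 + ln 1 - ln b)) \<le> (real N - 1) * 1"
      using N by (intro mult_left_mono young) auto
    ultimately have "b * (1 + ln t - ln b) + (real A - real N) * (b * (1 + ln a - ln b))
        + (real N - 1) * (b * (1 - ln b)) \<le> t + (real A - real N) * a + (real N - 1)"
      using young[OF t] by simp
    moreover have "b * (1 + ln t - ln b) + (real A - real N) * (b * (1 + ln a - ln b))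
        + (real N - 1) * (b * (1 - ln b))
      = b * real A + b * (ln t + real A * ln a - (real N * ln a + real A * ln b))"
      by (simp add: algebra_simps)
    moreover have "0 \<le> b * (ln t + real A * ln a - (real N * ln a + real A * ln b))"
      using 4 ln by simp
    ultimately have "b * real A \<le> t + (real A - real N) * a + (real N - 1)" by linarith
    then show ?thesis by (simp add: algebra_simps)
  qed
qed

section \<open>Positive semidefinite kernels\<close>

text \<open>
  Testing positive semidefiniteness against bounded functions keeps all integrals finite. Symmetry,
  nonnegativity and the bound hold everywhere so that products over edges need no exceptional
  sets.
\<close>

locale psd_kernel = prob_space M for M :: "real measure" +
  fixes k :: "real \<times> real \<Rightarrow> real" and K :: real
  assumes kernel_measurable [measurable]: "k \<in> borel_measurable (M \<Otimes>\<^sub>M M)"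
    and kernel_nonneg: "0 \<le> k p"
    and kernel_le: "k p \<le> K"
    and kernel_sym: "k (x, y) = k (y, x)"
    and kernel_psd: "\<lbrakk>f \<in> borel_measurable M; \<And>x. \<bar>f x\<bar> \<le> C\<rbrakk> \<Longrightarrow>
      0 \<le> (LINT x|M. f x * (LINT y|M. k (x, y) * f y))"
begin

definition test_fun :: "(real \<Rightarrow> real) \<Rightarrow> bool" where
  "test_fun f \<longleftrightarrow> f \<in> borel_measurable M \<and> (\<exists>C. \<forall>x. \<bar>f x\<bar> \<le> C)"

definition weight :: "(real \<Rightarrow> real) \<Rightarrow> bool" where
  "weight w \<longleftrightarrow> test_fun w \<and> (\<forall>x. 0 \<le> w x)"

definition deg :: "(real \<Rightarrow> real) \<Rightarrow> real \<Rightarrow> real" where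
  "deg w x = (LINT y|M. k (x, y) * w y)"

definition form :: "(real \<Rightarrow> real) \<Rightarrow> (real \<Rightarrow> real) \<Rightarrow> real" where
  "form f g = (LINT x|M. f x * deg g x)"

definition weighted_density ::
  "'a set \<Rightarrow> 'a set set \<Rightarrow> (real \<Rightarrow> real) \<Rightarrow> real" where
  "weighted_density V E w =
     (LINT x|PiM V (\<lambda>_. M). (\<Prod>v\<in>V. w (x v)) * (\<Prod>e\<in>E. edge_factor k x e))"

text \<open>
  This is the inequality \<open>density \<ge> I^N (P / I\<^sup>2)^e\<close> with the denominator cleared, so that weights of
  total mass \<open>I = 0\<close> need no exception.
\<close>

definition weighted_good :: "'a set \<Rightarrow> 'a set set \<Rightarrow> bool" where
  "weighted_good V E \<longleftrightarrow>
     (\<forall>w. weight w \<longrightarrow>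
        (LINT x|M. w x) ^ card V * form w w ^ card E
          \<le> weighted_density V E w * (LINT x|M. w x) ^ (2 * card E))"

lemma kernel_abs_le: "\<bar>k p\<bar> \<le> K"
  using kernel_nonneg[of p] kernel_le[of p] by simp

lemma bound_nonneg: "0 \<le> K"
  using kernel_nonneg kernel_le order_trans by blast

lemma test_fun_measurable: "test_fun f \<Longrightarrow> f \<in> borel_measurable M"
  by (simp add: test_fun_def)

lemma test_fun_integrable: "test_fun f \<Longrightarrow> integrable M f"
  unfolding test_fun_def by (auto intro!: integrable_const_bound AE_I2)

lemma test_fun_mult:
  assumes "test_fun f" "test_fun g"
  shows "test_fun (\<lambda>x. f x * g x)"
proof -
  obtain C D where C: "\<And>x. \<bar>f x\<bar> \<le> C" and D: "\<And>x. \<bar>g x\<bar> \<le> D"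
    using assms by (auto simp: test_fun_def)
  have "\<bar>f x * g x\<bar> \<le> C * D" for x
    unfolding abs_mult using C[of x] D[of x] by (intro mult_mono) auto
  then show ?thesis using assms by (auto simp: test_fun_def)
qed

lemma test_fun_add:
  assumes "test_fun f" "test_fun g"
  shows "test_fun (\<lambda>x. f x + g x)"
proof -
  obtain C D where C: "\<And>x. \<bar>f x\<bar> \<le> C" and D: "\<And>x. \<bar>g x\<bar> \<le> D"
    using assms by (auto simp: test_fun_def)
  have "\<bar>f x + g x\<bar> \<le> C + D" for x
    using C[of x] D[of x] by linarith
  then show ?thesis using assms by (auto simp: test_fun_def)
qed

lemma test_fun_const: "test_fun (\<lambda>_. c)"
  by (auto simp: test_fun_def)

lemma test_fun_kernel_slice: "y \<in> space M \<Longrightarrow> test_fun (\<lambda>x. k (x, y))"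
  unfolding test_fun_def using kernel_abs_le by auto

lemma test_fun_kernel_slice': "y \<in> space M \<Longrightarrow> test_fun (\<lambda>x. k (y, x))"
  unfolding test_fun_def using kernel_abs_le by auto

lemma test_fun_deg:
  assumes "test_fun w"
  shows "test_fun (deg w)"
proof -
  note [measurable] = test_fun_measurable[OF assms]
  obtain C where C: "\<And>x. \<bar>w x\<bar> \<le> C" using assms by (auto simp: test_fun_def)
  have "0 \<le> C" using C[of 0] by linarith
  have "\<bar>deg w x\<bar> \<le> K * C" for x
  proof (cases "integrable M (\<lambda>y. k (x, y) * w y)")
    case True
    have "\<bar>deg w x\<bar> \<le> (LINT y|M. \<bar>k (x, y) * w y\<bar>)"
      unfolding deg_def using integral_norm_bound[of M "\<lambda>y. k (x, y) * w y"] by simp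
    also have "\<dots> \<le> (LINT y|M. K * C)"
      using integrable_abs[OF True] C kernel_abs_le bound_nonneg
      by (intro integral_mono) (auto simp: abs_mult intro!: mult_mono)
    finally show ?thesis by (simp add: prob_space)
  next
    case False
    then show ?thesis
      using \<open>0 \<le> C\<close> bound_nonneg by (simp add: deg_def not_integrable_integral_eq)
  qed
  moreover have "deg w \<in> borel_measurable M"
    unfolding deg_def by measurable
  ultimately show ?thesis by (auto simp: test_fun_def)
qed

lemma weight_test_fun: "weight w \<Longrightarrow> test_fun w"
  and weight_nonneg: "weight w \<Longrightarrow> 0 \<le> w x"
  by (auto simp: weight_def)

lemma weight_mult: "weight f \<Longrightarrow> weight g \<Longrightarrow> weight (\<lambda>x. f x * g x)"
  by (simp add: weight_def test_fun_mult)

lemma weight_prod: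
  "finite S \<Longrightarrow> (\<And>s. s \<in> S \<Longrightarrow> weight (f s)) \<Longrightarrow> weight (\<lambda>x. \<Prod>s\<in>S. f s x)"
  by (induction S rule: finite_induct)
     (auto simp: weight_mult weight_def[of "\<lambda>_. 1"] test_fun_const)

lemma weight_power: "weight f \<Longrightarrow> weight (\<lambda>x. f x ^ n)"
  by (induction n) (auto simp: weight_mult weight_def[of "\<lambda>_. 1"] test_fun_const)

lemma weight_kernel_slice: "y \<in> space M \<Longrightarrow> weight (\<lambda>x. k (x, y))"
  by (simp add: weight_def test_fun_kernel_slice kernel_nonneg)

lemma weight_deg: "weight w \<Longrightarrow> weight (deg w)"
  unfolding weight_def
  by (auto simp: test_fun_deg deg_def kernel_nonneg intro!: integral_nonneg_AE AE_I2)

lemma integral_weight_nonneg: "weight w \<Longrightarrow> 0 \<le> (LINT x|M. w x)"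
  by (simp add: weight_nonneg)

lemma form_nonneg: "weight f \<Longrightarrow> weight g \<Longrightarrow> 0 \<le> form f g"
  unfolding form_def by (simp add: weight_nonneg weight_deg)

lemma deg_lincomb:
  assumes "test_fun f" "test_fun g" "x \<in> space M"
  shows "deg (\<lambda>x. a * f x + b * g x) x = a * deg f x + b * deg g x"
proof -
  have "deg (\<lambda>x. a * f x + b * g x) x
      = (LINT y|M. a * (k (x, y) * f y) + b * (k (x, y) * g y))"
    unfolding deg_def by (simp add: algebra_simps)
  also have "\<dots> = a * deg f x + b * deg g x"
    using assms unfolding deg_def
    by (simp add: test_fun_integrable test_fun_mult test_fun_kernel_slice')
  finally show ?thesis .
qed

lemma form_sym:
  assumes "test_fun f" "test_fun g"
  shows "form f g = form g f"
proof -
  interpret pair_prob_space M M by unfold_locales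
  note [measurable] = assms[THEN test_fun_measurable]
  obtain C D where C: "\<And>x. \<bar>f x\<bar> \<le> C" and D: "\<And>x. \<bar>g x\<bar> \<le> D"
    using assms by (auto simp: test_fun_def)
  have "0 \<le> C" "0 \<le> D" using C[of 0] D[of 0] by linarith+
  have int: "integrable (M \<Otimes>\<^sub>M M) (\<lambda>(x, y). f x * (k (x, y) * g y))"
    using C D kernel_abs_le \<open>0 \<le> C\<close> \<open>0 \<le> D\<close> bound_nonneg
    by (intro P.integrable_const_bound[of _ "C * (K * D)"])
       (auto simp: abs_mult split_beta intro!: mult_mono AE_I2)
  have "form f g = (LINT x|M. LINT y|M. f x * (k (x, y) * g y))"
    by (simp add: form_def deg_def)
  also have "\<dots> = (LINT y|M. LINT x|M. f x * (k (x, y) * g y))"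
    using Fubini_integral[OF int] by simp
  also have "\<dots> = (LINT y|M. LINT x|M. g y * (k (y, x) * f x))"
    by (simp add: mult_ac kernel_sym)
  also have "\<dots> = form g f"
    by (simp add: form_def deg_def)
  finally show ?thesis .
qed

lemma form_lincomb:
  assumes f: "test_fun f" and g: "test_fun g"
  shows "form (\<lambda>x. a * f x + b * g x) (\<lambda>x. a * f x + b * g x)
    = a\<^sup>2 * form f f + 2 * a * b * form f g + b\<^sup>2 * form g g"
proof -
  have "form (\<lambda>x. a * f x + b * g x) (\<lambda>x. a * f x + b * g x)
      = (LINT x|M. (a * f x + b * g x) * (a * deg f x + b * deg g x))"
    unfolding form_def by (intro Bochner_Integration.integral_cong) (auto simp: deg_lincomb f g)
  also have "\<dots> = (LINT x|M. a\<^sup>2 * (f x * deg f x) + a * b * (f x * deg g x)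
      + a * b * (g x * deg f x) + b\<^sup>2 * (g x * deg g x))"
    by (simp add: algebra_simps power2_eq_square)
  also have "\<dots> = a\<^sup>2 * form f f + a * b * form f g + a * b * form g f + b\<^sup>2 * form g g"
    unfolding form_def using f g
    by (simp add: test_fun_integrable test_fun_mult test_fun_deg)
  finally show ?thesis using form_sym[OF f g] by simp
qed

text \<open>
  The usual discriminant argument, written out because the form may be degenerate.
\<close>

lemma form_Cauchy_Schwarz:
  assumes f: "test_fun f" and g: "test_fun g"
  shows "(form f g)\<^sup>2 \<le> form f f * form g g"
proof -
  have psd: "0 \<le> form h h" if "test_fun h" for h
    using that kernel_psd unfolding form_def deg_def test_fun_def by blast
  have quad: "0 \<le> a\<^sup>2 * form f f + 2 * a * b * form f g + b\<^sup>2 * form g g" for a b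
    unfolding form_lincomb[OF f g, symmetric]
    by (intro psd test_fun_add test_fun_mult test_fun_const f g)
  show ?thesis
  proof (cases "form g g = 0")
    case True
    have "form f g = 0"
    proof (rule ccontr)
      assume "form f g \<noteq> 0"
      then show False
        using quad[of 1 "- (form f f + 1) / (2 * form f g)"] True
        by (simp add: field_simps)
    qed
    then show ?thesis using True by simp
  next
    case False
    then have pos: "form g g > 0" using psd[OF g] by simp
    have "0 \<le> form g g * (form f f * form g g - (form f g)\<^sup>2)"
      using quad[of "form g g" "- form f g"] by (simp add: algebra_simps power2_eq_square)
    then show ?thesis using pos by (simp add: zero_le_mult_iff)
  qed
qed

lemma form_eq_0:
  assumes "weight w" "(LINT x|M. w x) = 0"
  shows "form w w = 0"
proof -
  have "AE x in M. w x = 0"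
    using integral_nonneg_eq_0_iff_AE[of M w] assms
    by (simp add: test_fun_integrable weight_test_fun weight_nonneg)
  then have "form w w = (LINT x|M. 0)"
    unfolding form_def using assms
    by (intro integral_cong_AE test_fun_measurable test_fun_mult test_fun_deg weight_test_fun
        test_fun_const) auto
  then show ?thesis by simp
qed

text \<open>
  With \<open>m\<close> the mean of the degree under the weight \<open>w\<close>, this says that \<open>d^n\<close> and \<open>d\<close> are
  positively correlated, which follows from \<open>(d^n - m^n) (d - m) \<ge> 0\<close>.
\<close>

lemma deg_moment_mono:
  assumes "weight w"
  shows "(LINT x|M. w x * deg w x ^ n) * form w w
    \<le> (LINT x|M. w x * deg w x ^ Suc n) * (LINT x|M. w x)"
proof (cases "(LINT x|M. w x) = 0")
  case True
  then show ?thesis using form_eq_0[OF assms] by simp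
next
  case False
  define I where "I = (LINT x|M. w x)"
  have I: "0 < I" using False integral_weight_nonneg[OF assms] by (simp add: I_def)
  define m where "m = form w w / I"
  have m: "0 \<le> m" using I by (simp add: m_def form_nonneg assms)
  have ww: "weight (deg w)" by (rule weight_deg[OF assms])
  have int: "integrable M (\<lambda>x. w x * deg w x ^ j)" for j
    by (intro test_fun_integrable weight_test_fun weight_mult weight_power ww assms)
  have int1: "integrable M (\<lambda>x. w x * deg w x)" "integrable M w"
    using int[of 1] int[of 0] by simp_all
  have "0 = m ^ n * ((LINT x|M. w x * deg w x) - m * I)"
    using I by (simp add: m_def form_def)
  also have "\<dots> = (LINT x|M. m ^ n * (w x * deg w x - m * w x))"
    using int1 by (simp add: I_def)
  also have "\<dots> \<le> (LINT x|M. w x * deg w x ^ Suc n - m * (w x * deg w x ^ n))"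
  proof (intro integral_mono)
    fix x
    have "0 \<le> (deg w x ^ n - m ^ n) * (deg w x - m)"
    proof (cases "m \<le> deg w x")
      case True
      then show ?thesis using m by (simp add: power_mono)
    next
      case False
      then show ?thesis using weight_nonneg[OF ww, of x]
        by (simp add: power_mono mult_nonpos_nonpos)
    qed
    then have "0 \<le> w x * ((deg w x ^ n - m ^ n) * (deg w x - m))"
      using weight_nonneg[OF assms] by simp
    then show "m ^ n * (w x * deg w x - m * w x) \<le> w x * deg w x ^ Suc n - m * (w x * deg w x ^ n)"
      by (simp add: algebra_simps)
  qed (use int int1 int[of "Suc n"] in \<open>auto simp del: power_Suc\<close>)
  also have "\<dots> = (LINT x|M. w x * deg w x ^ Suc n) - m * (LINT x|M. w x * deg w x ^ n)"
    using int[of n] int[of "Suc n"] by (simp del: power_Suc)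
  finally have "m * (LINT x|M. w x * deg w x ^ n) * I \<le> (LINT x|M. w x * deg w x ^ Suc n) * I"
    using I by (intro mult_right_mono) auto
  then show ?thesis using I by (simp add: m_def I_def mult_ac)
qed

end

section \<open>Joins of graphs\<close>

definition join_edges :: "'a set \<Rightarrow> 'a set \<Rightarrow> 'a set set" where
  "join_edges V S = (\<lambda>(v, s). {v, s}) ` (V \<times> S)"

lemma inj_on_join_edges: "V \<inter> S = {} \<Longrightarrow> inj_on (\<lambda>(v, s). {v, s}) (V \<times> S)"
  by (auto simp: inj_on_def doubleton_eq_iff)

lemma card_join_edges: "V \<inter> S = {} \<Longrightarrow> card (join_edges V S) = card V * card S"
  unfolding join_edges_def by (simp add: card_image inj_on_join_edges card_cartesian_product)

lemma vertex_pairs_join_disjoint: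
  "V \<inter> S = {} \<Longrightarrow> E \<subseteq> vertex_pairs V \<Longrightarrow> E \<inter> join_edges V S = {}"
  by (auto simp: join_edges_def vertex_pairs_def)

lemma join_edges_subset:
  assumes "V \<inter> S = {}"
  shows "join_edges V S \<subseteq> vertex_pairs (V \<union> S)"
proof -
  have "card {v, s} = 2" if "v \<in> V" "s \<in> S" for v s
    using that assms by (auto simp: card_insert_if)
  then show ?thesis by (auto simp: join_edges_def vertex_pairs_def)
qed

lemma vertex_pairs_mono: "V \<subseteq> W \<Longrightarrow> vertex_pairs V \<subseteq> vertex_pairs W"
  by (auto simp: vertex_pairs_def)

lemma finite_vertex_pairs: "finite V \<Longrightarrow> finite (vertex_pairs V)"
  by (rule finite_subset[of _ "Pow V"]) (auto simp: vertex_pairs_def)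

section \<open>Weighted densities\<close>

context psd_kernel
begin

lemma weight_bound:
  assumes "weight w"
  obtains C where "0 \<le> C" "\<And>x. w x \<le> C"
proof -
  obtain C where C: "\<bar>w x\<bar> \<le> C" for x using assms by (force simp: weight_def test_fun_def)
  then have "w x \<le> C" for x using abs_le_D1 by blast
  then show thesis using that[of C] C[of 0] by force
qed

lemma vertex_pairE:
  assumes "e \<in> vertex_pairs V"
  obtains u v where "u \<in> V" "v \<in> V" "e = {u, v}" "\<And>x. edge_factor k x e = k (x u, x v)"
proof -
  obtain u v where "u \<in> V" "v \<in> V" "e = {u, v}"
    using assms by (auto simp: vertex_pairs_def card_2_iff)
  moreover have "edge_factor k x {u, v} = k (x u, x v)" for x
    by (rule edge_factor_doubleton) (rule kernel_sym)
  ultimately show thesis by (intro that[of u v]) auto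
qed

lemma edge_factor_measurable:
  assumes "e \<in> vertex_pairs V"
  shows "(\<lambda>x. edge_factor k x e) \<in> borel_measurable (PiM V (\<lambda>_. M))"
proof -
  obtain u v where [measurable]: "u \<in> V" "v \<in> V" and *: "\<And>x. edge_factor k x e = k (x u, x v)"
    using assms by (metis vertex_pairE)
  show ?thesis unfolding * by measurable
qed

lemma edge_factor_bounds:
  assumes "e \<in> vertex_pairs V"
  shows "0 \<le> edge_factor k x e" "edge_factor k x e \<le> K"
  using assms by (auto elim!: vertex_pairE simp: kernel_nonneg kernel_le)

text \<open>
  Naming the integrand of the weighted density allows its measurability, bounds and
  integrability to be established once.
\<close>

definition density_integrand :: "'a set \<Rightarrow> 'a set set \<Rightarrow> (real \<Rightarrow> real) \<Rightarrow> ('a \<Rightarrow> real) \<Rightarrow> real" where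
  "density_integrand V E w x = (\<Prod>v\<in>V. w (x v)) * (\<Prod>e\<in>E. edge_factor k x e)"

lemma density_integrand_nonneg:
  "E \<subseteq> vertex_pairs V \<Longrightarrow> weight w \<Longrightarrow> 0 \<le> density_integrand V E w x"
  unfolding density_integrand_def
  by (intro mult_nonneg_nonneg prod_nonneg ballI weight_nonneg edge_factor_bounds) auto

lemma density_integrand_le:
  assumes "E \<subseteq> vertex_pairs V" "weight w" "\<And>x. w x \<le> C"
  shows "density_integrand V E w x \<le> C ^ card V * K ^ card E"
proof -
  have "(\<Prod>v\<in>V. w (x v)) \<le> (\<Prod>v\<in>V. C)" "(\<Prod>e\<in>E. edge_factor k x e) \<le> (\<Prod>e\<in>E. K)"
    using assms by (intro prod_mono; auto simp: weight_nonneg edge_factor_bounds)+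
  moreover have "0 \<le> C" using assms weight_nonneg order_trans by blast
  ultimately have "density_integrand V E w x \<le> (\<Prod>v\<in>V. C) * (\<Prod>e\<in>E. K)"
    unfolding density_integrand_def using assms
    by (intro mult_mono prod_nonneg ballI edge_factor_bounds) auto
  then show ?thesis by simp
qed

lemma density_integrand_measurable:
  assumes "E \<subseteq> vertex_pairs V" "weight w"
  shows "density_integrand V E w \<in> borel_measurable (PiM V (\<lambda>_. M))"
proof -
  have [measurable]: "(\<lambda>x. edge_factor k x e) \<in> borel_measurable (PiM V (\<lambda>_. M))" if "e \<in> E" for e
    using that assms edge_factor_measurable by blast
  note [measurable] = test_fun_measurable[OF weight_test_fun[OF assms(2)]]
  show ?thesis unfolding density_integrand_def by measurable
qed

lemma density_integrand_integrable:
  assumes "E \<subseteq> vertex_pairs V" "weight w"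
  shows "integrable (PiM V (\<lambda>_. M)) (density_integrand V E w)"
proof -
  obtain C where C: "0 \<le> C" "\<And>x. w x \<le> C" using assms(2) by (rule weight_bound) auto
  interpret PV: prob_space "PiM V (\<lambda>_. M)" by (rule prob_space_PiM) unfold_locales
  show ?thesis
    using density_integrand_nonneg[OF assms] density_integrand_le[OF assms C(2)]
    by (intro PV.integrable_const_bound[of _ "C ^ card V * K ^ card E"]
        density_integrand_measurable assms) (auto intro!: AE_I2)
qed

lemma weighted_density_bounds:
  assumes "E \<subseteq> vertex_pairs V" "weight w" "\<And>x. w x \<le> C"
  shows "0 \<le> weighted_density V E w" "weighted_density V E w \<le> C ^ card V * K ^ card E"
proof -
  interpret PV: prob_space "PiM V (\<lambda>_. M)" by (rule prob_space_PiM) unfold_locales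
  have eq: "weighted_density V E w = (LINT x|PiM V (\<lambda>_. M). density_integrand V E w x)"
    by (simp add: weighted_density_def density_integrand_def)
  show "0 \<le> weighted_density V E w"
    unfolding eq using assms by (simp add: density_integrand_nonneg)
  have "weighted_density V E w \<le> (LINT x|PiM V (\<lambda>_. M). C ^ card V * K ^ card E)"
    unfolding eq using assms
    by (intro integral_mono density_integrand_integrable density_integrand_le) auto
  then show "weighted_density V E w \<le> C ^ card V * K ^ card E"
    by (simp add: PV.prob_space)
qed

section \<open>Joining an independent set\<close>

text \<open>
  The weight on the old vertices once the positions \<open>z\<close> of the vertices of a joined independent set
  \<open>S\<close> are fixed: every edge from a vertex at \<open>x\<close> to \<open>S\<close> contributes its factor to the vertex.
\<close>

definition cone_weight :: "(real \<Rightarrow> real) \<Rightarrow> 'a set \<Rightarrow> ('a \<Rightarrow> real) \<Rightarrow> real \<Rightarrow> real" where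
  "cone_weight w S z x = w x * (\<Prod>s\<in>S. k (x, z s))"

lemma weight_cone_weight:
  assumes "weight w" "finite S" "z \<in> space (PiM S (\<lambda>_. M))"
  shows "weight (cone_weight w S z)"
  unfolding cone_weight_def using assms
  by (intro weight_mult weight_prod weight_kernel_slice) (auto simp: space_PiM)

lemma cone_weight_le:
  assumes "weight w" "\<And>x. w x \<le> C"
  shows "cone_weight w S z x \<le> C * K ^ card S"
proof -
  have "(\<Prod>s\<in>S. k (x, z s)) \<le> (\<Prod>s\<in>S. K)"
    by (intro prod_mono) (simp add: kernel_nonneg kernel_le)
  moreover have "0 \<le> C" using assms weight_nonneg order_trans by blast
  ultimately have "cone_weight w S z x \<le> C * (\<Prod>s\<in>S. K)"
    unfolding cone_weight_def using assms
    by (intro mult_mono prod_nonneg) (auto simp: kernel_nonneg)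
  then show ?thesis by simp
qed

text \<open>
  After interchanging the integrals, the coordinates of \<open>z\<close> are independent and each of them
  contributes one factor \<open>deg w x\<close>. The lemma is used for \<open>u = w\<close> and for \<open>u = w * deg w\<close>.
\<close>

lemma integral_cone_weight:
  assumes w: "weight w" and u: "weight u" and S: "finite S"
  shows "(LINT z|PiM S (\<lambda>_. M). (\<Prod>s\<in>S. w (z s)) * (LINT x|M. cone_weight u S z x))
    = (LINT x|M. u x * deg w x ^ card S)" (is ?eq)
    and "integrable (PiM S (\<lambda>_. M))
      (\<lambda>z. (\<Prod>s\<in>S. w (z s)) * (LINT x|M. cone_weight u S z x))" (is ?int)
proof -
  note [measurable] = test_fun_measurable[OF weight_test_fun[OF w]]
    test_fun_measurable[OF weight_test_fun[OF u]]
  obtain C where C: "0 \<le> C" "\<And>x. w x \<le> C" using w by (rule weight_bound) auto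
  obtain D where D: "0 \<le> D" "\<And>x. u x \<le> D" using u by (rule weight_bound) auto
  interpret PS: prob_space "PiM S (\<lambda>_. M)" by (rule prob_space_PiM) unfold_locales
  interpret pair_prob_space "PiM S (\<lambda>_. M)" M by unfold_locales
  interpret PM: product_prob_space "\<lambda>_. M" by unfold_locales
  let ?f = "\<lambda>z x. (\<Prod>s\<in>S. w (z s)) * cone_weight u S z x"
  have bnd: "0 \<le> (\<Prod>s\<in>S. w (z s))" "(\<Prod>s\<in>S. w (z s)) \<le> C ^ card S"
    "0 \<le> cone_weight u S z x" "cone_weight u S z x \<le> D * K ^ card S" for z x
    using prod_mono[of S "\<lambda>s. w (z s)" "\<lambda>_. C"] C D w u
    by (auto simp: weight_nonneg prod_nonneg cone_weight_def[of u] kernel_nonneg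
        cone_weight_le[OF u D(2), unfolded cone_weight_def])
  have int: "integrable (PiM S (\<lambda>_. M) \<Otimes>\<^sub>M M) (case_prod ?f)"
  proof (rule P.integrable_const_bound[of _ "C ^ card S * (D * K ^ card S)"])
    show "AE p in PiM S (\<lambda>_. M) \<Otimes>\<^sub>M M. norm (case_prod ?f p) \<le> C ^ card S * (D * K ^ card S)"
      using bnd C D bound_nonneg by (intro AE_I2) (auto simp: abs_mult intro!: mult_mono)
    show "case_prod ?f \<in> borel_measurable (PiM S (\<lambda>_. M) \<Otimes>\<^sub>M M)"
      unfolding cone_weight_def by measurable
  qed
  have "(LINT z|PiM S (\<lambda>_. M). LINT x|M. ?f z x) = (LINT x|M. LINT z|PiM S (\<lambda>_. M). ?f z x)"
    using Fubini_integral[OF int] by simp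
  also have "\<dots> = (LINT x|M. u x * deg w x ^ card S)"
  proof (intro Bochner_Integration.integral_cong refl)
    fix x assume x: "x \<in> space M"
    have "(LINT z|PiM S (\<lambda>_. M). ?f z x)
        = (LINT z|PiM S (\<lambda>_. M). u x * (\<Prod>s\<in>S. k (x, z s) * w (z s)))"
      by (simp add: cone_weight_def prod.distrib mult_ac)
    also have "\<dots> = u x * (\<Prod>s\<in>S. deg w x)"
      unfolding deg_def
      by (subst integral_mult_right_zero, subst PM.product_integral_prod[OF S])
         (intro test_fun_integrable test_fun_mult test_fun_kernel_slice' weight_test_fun w x, rule refl)
    finally show "(LINT z|PiM S (\<lambda>_. M). ?f z x) = u x * deg w x ^ card S" by simp
  qed
  finally show ?eq by simp
  show ?int using integrable_fst[OF int] by simp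
qed

text \<open>
  Integrating over the old vertices first turns the density of a join into an average of
  densities of the old graph.
\<close>

lemma weighted_density_join:
  fixes V S :: "'a set"
  assumes w: "weight w" and fin: "finite V" "finite S" and VS: "V \<inter> S = {}"
    and E: "E \<subseteq> vertex_pairs V"
  shows "weighted_density (V \<union> S) (E \<union> join_edges V S) w
    = (LINT z|PiM S (\<lambda>_. M). (\<Prod>s\<in>S. w (z s)) * weighted_density V E (cone_weight w S z))"
proof -
  interpret PM: product_prob_space "\<lambda>_. M" by unfold_locales
  let ?E = "E \<union> join_edges V S"
  have E': "?E \<subseteq> vertex_pairs (S \<union> V)"
    using E join_edges_subset[OF VS] vertex_pairs_mono[of V "S \<union> V"] by (auto simp: Un_commute)
  have finE: "finite E" using E fin finite_vertex_pairs finite_subset by blast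
  have "weighted_density (V \<union> S) ?E w
      = (LINT x|PiM (S \<union> V) (\<lambda>_. M). density_integrand (S \<union> V) ?E w x)"
    by (simp add: weighted_density_def density_integrand_def Un_commute)
  also have "\<dots> = (LINT z|PiM S (\<lambda>_. M). LINT x|PiM V (\<lambda>_. M).
      density_integrand (S \<union> V) ?E w (merge S V (z, x)))"
    using VS fin E' w
    by (intro PM.product_integral_fold density_integrand_integrable) (auto simp: Int_commute)
  finally have fold: "weighted_density (V \<union> S) ?E w = (LINT z|PiM S (\<lambda>_. M). LINT x|PiM V (\<lambda>_. M).
      density_integrand (S \<union> V) ?E w (merge S V (z, x)))" .
  have "density_integrand (S \<union> V) ?E w (merge S V (z, x))
      = (\<Prod>s\<in>S. w (z s)) * density_integrand V E (cone_weight w S z) x" for z x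
  proof -
    let ?m = "merge S V (z, x)"
    have mS: "?m s = z s" if "s \<in> S" for s using that by (simp add: merge_def)
    have mV: "?m v = x v" if "v \<in> V" for v using that VS by (auto simp: merge_def)
    have "(\<Prod>v\<in>S \<union> V. w (?m v)) = (\<Prod>s\<in>S. w (z s)) * (\<Prod>v\<in>V. w (x v))"
      using fin VS by (subst prod.union_disjoint) (auto simp: mS mV)
    moreover have "(\<Prod>e\<in>?E. edge_factor k ?m e)
        = (\<Prod>e\<in>E. edge_factor k ?m e) * (\<Prod>e\<in>join_edges V S. edge_factor k ?m e)"
      using finE fin vertex_pairs_join_disjoint[OF VS E]
      by (intro prod.union_disjoint) (auto simp: join_edges_def)
    moreover have "(\<Prod>e\<in>E. edge_factor k ?m e) = (\<Prod>e\<in>E. edge_factor k x e)"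
    proof (intro prod.cong refl)
      fix e assume "e \<in> E"
      then have "e \<in> vertex_pairs V" using E by auto
      then show "edge_factor k ?m e = edge_factor k x e"
        by (rule vertex_pairE) (simp add: mV)
    qed
    moreover have "(\<Prod>e\<in>join_edges V S. edge_factor k ?m e) = (\<Prod>v\<in>V. \<Prod>s\<in>S. k (x v, z s))"
      unfolding join_edges_def prod.reindex[OF inj_on_join_edges[OF VS]] prod.cartesian_product
      by (intro prod.cong refl)
         (auto simp: edge_factor_doubleton kernel_sym mS mV)
    ultimately show ?thesis
      by (simp add: density_integrand_def cone_weight_def prod.distrib mult_ac)
  qed
  then show ?thesis
    unfolding fold by (simp add: weighted_density_def density_integrand_def)
qed

lemma weighted_density_cone_integrable:
  fixes V S :: "'a set"
  assumes w: "weight w" and fin: "finite S" and E: "E \<subseteq> vertex_pairs V"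
  shows "integrable (PiM S (\<lambda>_. M))
    (\<lambda>z. (\<Prod>s\<in>S. w (z s)) * weighted_density V E (cone_weight w S z))"
proof -
  note [measurable] = test_fun_measurable[OF weight_test_fun[OF w]]
  obtain C where C: "0 \<le> C" "\<And>x. w x \<le> C" using w by (rule weight_bound) auto
  interpret PS: prob_space "PiM S (\<lambda>_. M)" by (rule prob_space_PiM) unfold_locales
  interpret PV: prob_space "PiM V (\<lambda>_. M)" by (rule prob_space_PiM) unfold_locales
  let ?B = "(C * K ^ card S) ^ card V * K ^ card E"
  have bnd: "0 \<le> (\<Prod>s\<in>S. w (z s))" "(\<Prod>s\<in>S. w (z s)) \<le> C ^ card S" for z
    using prod_mono[of S "\<lambda>s. w (z s)" "\<lambda>_. C"] C w by (auto simp: weight_nonneg prod_nonneg)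
  have [measurable]: "(\<lambda>p. edge_factor k (snd p) e)
      \<in> borel_measurable (PiM S (\<lambda>_. M) \<Otimes>\<^sub>M PiM V (\<lambda>_. M))" if "e \<in> E" for e
    using that E edge_factor_measurable by (intro measurable_compose[OF measurable_snd]) auto
  have [measurable]: "(\<lambda>z. weighted_density V E (cone_weight w S z)) \<in> borel_measurable (PiM S (\<lambda>_. M))"
    unfolding weighted_density_def cone_weight_def
    by (intro PV.borel_measurable_lebesgue_integral) (simp add: split_beta)
  show ?thesis
  proof (rule PS.integrable_const_bound[of _ "C ^ card S * ?B"])
    show "AE z in PiM S (\<lambda>_. M).
        norm ((\<Prod>s\<in>S. w (z s)) * weighted_density V E (cone_weight w S z)) \<le> C ^ card S * ?B"
    proof (intro AE_I2)
      fix z assume "z \<in> space (PiM S (\<lambda>_. M))"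
      note wd = weighted_density_bounds[OF E weight_cone_weight[OF w fin this] cone_weight_le[OF w C(2)]]
      then show "norm ((\<Prod>s\<in>S. w (z s)) * weighted_density V E (cone_weight w S z)) \<le> C ^ card S * ?B"
        using bnd[of z] C by (auto simp: abs_mult intro!: mult_mono)
    qed
  qed measurable
qed

lemma deg_moment_ge:
  assumes w: "weight w" and pos: "0 < (LINT x|M. w x)"
  shows "(form w w / (LINT x|M. w x)) ^ n * (LINT x|M. w x) \<le> (LINT x|M. w x * deg w x ^ n)"
proof (induction n)
  case (Suc n)
  let ?I = "LINT x|M. w x" and ?m = "form w w / (LINT x|M. w x)"
  have "?m ^ Suc n * ?I \<le> ?m * (LINT x|M. w x * deg w x ^ n)"
    using mult_left_mono[OF Suc, of ?m] form_nonneg[OF w w] pos by (simp add: mult_ac)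
  also have "\<dots> \<le> (LINT x|M. w x * deg w x ^ Suc n)"
    using deg_moment_mono[OF w, of n] pos by (simp add: field_simps del: power_Suc)
  finally show ?case .
qed simp

text \<open>
  The induction step. The hypothesis on \<open>E\<close> is what makes the lower bound for the inner density
  convex in \<open>(c, q)\<close>; it holds for every nonempty complete multipartite graph with at least two
  parts, and for the edgeless graph that forms the first part.
\<close>

lemma weighted_good_join:
  fixes V S :: "'a set"
  assumes fin: "finite V" "finite S" and ne: "V \<noteq> {}" "S \<noteq> {}" and VS: "V \<inter> S = {}"
    and E: "E \<subseteq> vertex_pairs V" and good: "weighted_good V E"
    and dense: "E = {} \<or> card V \<le> 2 * card E"
  shows "weighted_good (V \<union> S) (E \<union> join_edges V S)"
  unfolding weighted_good_def
proof (intro allI impI)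
  fix w assume w: "weight w"
  define N e s where "N = card V" and "e = card E" and "s = card S"
  have finE: "finite E" using E fin finite_vertex_pairs finite_subset by blast
  have N: "1 \<le> N" and s: "1 \<le> s"
    using fin ne by (auto simp: N_def s_def Suc_le_eq card_gt_0_iff)
  have cardV: "card (V \<union> S) = N + s"
    using fin VS by (simp add: card_Un_disjoint N_def s_def)
  have "finite (join_edges V S)" using fin by (simp add: join_edges_def)
  then have cardE: "card (E \<union> join_edges V S) = e + N * s"
    using finE VS vertex_pairs_join_disjoint[OF VS E]
    by (simp add: card_Un_disjoint card_join_edges N_def s_def e_def)
  define I P where "I = (LINT x|M. w x)" and "P = form w w"
  define T where "T = weighted_density (V \<union> S) (E \<union> join_edges V S) w"
  have I: "0 \<le> I" and P: "0 \<le> P"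
    using w by (simp_all add: I_def P_def form_nonneg integral_weight_nonneg)
  have T: "0 \<le> T"
    using E join_edges_subset[OF VS] vertex_pairs_mono[of V "V \<union> S"] w
      weight_bound[OF w] unfolding T_def
    by (metis Un_upper1 le_sup_iff order_trans weighted_density_bounds(1))
  have "I ^ (N + s) * P ^ (e + N * s) \<le> T * I ^ (2 * (e + N * s))"
  proof (cases "P = 0")
    case True
    moreover have "e + N * s \<noteq> 0" using N s by simp
    ultimately have "I ^ (N + s) * P ^ (e + N * s) = 0" by simp
    then show ?thesis using T I by (simp only: mult_nonneg_nonneg zero_le_power)
  next
    case False
    then have P0: "0 < P" using P by simp
    have I0: "0 < I" using form_eq_0[OF w] False I by (auto simp: I_def P_def order_le_less)
    define m where "m = P / I"
    have m: "0 < m" using P0 I0 by (simp add: m_def)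
    define D where "D n = (LINT x|M. w x * deg w x ^ n)" for n
    have D_Suc: "m * D n \<le> D (Suc n)" for n
      using deg_moment_mono[OF w, of n, folded D_def P_def I_def] I0
      by (simp add: m_def field_simps)
    have D_ge: "m ^ n * I \<le> D n" for n
      using deg_moment_ge[OF w I0[unfolded I_def], of n] by (simp add: D_def m_def I_def P_def)
    have D_pos: "0 < D n" for n
      using D_ge[of n] m I0 by (meson less_le_trans mult_pos_pos zero_less_power)
    \<comment> \<open>The means of \<open>c\<close> and \<open>q\<close> below, that is, the point of tangency.\<close>
    define C0 Q0 where "C0 = D s / I ^ s" and "Q0 = D (Suc s) / I ^ s"
    have C0: "0 < C0" and Q0: "0 < Q0" using D_pos I0 by (simp_all add: C0_def Q0_def)
    define t0 where "t0 = C0 ^ N * (Q0 / C0) ^ (2 * e)"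
    have t0: "0 < t0" using C0 Q0 by (simp add: t0_def)

    define om where "om z = (\<Prod>s\<in>S. w (z s))" for z
    define c where "c z = (LINT x|M. cone_weight w S z x)" for z
    define q where "q z = (LINT x|M. cone_weight w S z x * deg w x)" for z
    define U where "U z = weighted_density V E (cone_weight w S z)" for z
    let ?PS = "PiM S (\<lambda>_. M)"
    interpret PM: product_prob_space "\<lambda>_. M" by unfold_locales

    have int_U: "integrable ?PS (\<lambda>z. om z * U z)"
      and T_eq: "T = (LINT z|?PS. om z * U z)"
      unfolding om_def U_def T_def
      using weighted_density_cone_integrable[OF w fin(2) E] weighted_density_join[OF w fin VS E]
      by auto
    have int_om: "integrable ?PS om"
      unfolding om_def using fin w by (intro PM.product_integrable_prod test_fun_integrable weight_test_fun)
    have om_eq: "(LINT z|?PS. om z) = I ^ s"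
      unfolding om_def using fin w
      by (subst PM.product_integral_prod) (auto intro: test_fun_integrable weight_test_fun simp: I_def s_def)
    have int_c: "integrable ?PS (\<lambda>z. om z * c z)"
      and c_eq: "(LINT z|?PS. om z * c z) = C0 * I ^ s"
      using integral_cone_weight[OF w w fin(2)] I0
      by (simp_all add: om_def c_def C0_def D_def s_def)
    have cw: "cone_weight (\<lambda>x. w x * deg w x) S z x = cone_weight w S z x * deg w x" for z x
      by (simp add: cone_weight_def)
    have int_q: "integrable ?PS (\<lambda>z. om z * q z)"
      and q_eq: "(LINT z|?PS. om z * q z) = Q0 * I ^ s"
      using integral_cone_weight[OF w weight_mult[OF w weight_deg[OF w]] fin(2)] I0
      by (simp_all add: om_def q_def Q0_def D_def s_def cw mult_ac)

    \<comment> \<open>Induction hypothesis, Cauchy-Schwarz and the tangent plane for a fixed position of \<open>S\<close>.\<close>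
    have pointwise: "1 + real (2 * e) * (q z / Q0 - 1) + (real N - real (2 * e)) * (c z / C0 - 1)
        \<le> U z * P ^ e / t0" if z: "z \<in> space ?PS" for z
    proof (rule tangent_plane_bound)
      let ?W = "cone_weight w S z"
      have W: "weight ?W" by (rule weight_cone_weight[OF w fin(2) z])
      show c: "0 \<le> c z / C0" and "0 \<le> q z / Q0"
        using C0 Q0 by (auto simp: c_def q_def weight_nonneg[OF W] weight_nonneg[OF weight_deg[OF w]])
      obtain B where "\<And>x. ?W x \<le> B" using W by (rule weight_bound) auto
      then have "0 \<le> U z" unfolding U_def by (rule weighted_density_bounds[OF E W])
      then show "0 \<le> U z * P ^ e / t0" using P t0 by simp
      have "(q z)\<^sup>2 \<le> form ?W ?W * P"
        using form_Cauchy_Schwarz[of ?W w] W w by (simp add: weight_test_fun q_def P_def form_def)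
      then have "((q z)\<^sup>2) ^ e \<le> (form ?W ?W * P) ^ e"
        by (intro power_mono) auto
      then have "c z ^ N * q z ^ (2 * e) \<le> c z ^ N * (form ?W ?W * P) ^ e"
        using c C0 by (intro mult_left_mono) (auto simp: power_mult zero_le_divide_iff)
      also have "\<dots> = (c z ^ N * form ?W ?W ^ e) * P ^ e"
        by (simp add: power_mult_distrib)
      also have "\<dots> \<le> (U z * c z ^ (2 * e)) * P ^ e"
        using good W P unfolding weighted_good_def
        by (intro mult_right_mono) (auto simp: N_def e_def U_def c_def)
      finally have "c z ^ N * q z ^ (2 * e) / (C0 ^ N * Q0 ^ (2 * e))
          \<le> (U z * c z ^ (2 * e)) * P ^ e / (C0 ^ N * Q0 ^ (2 * e))"
        using C0 Q0 by (intro divide_right_mono) auto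
      then show "(c z / C0) ^ N * (q z / Q0) ^ (2 * e)
          \<le> U z * P ^ e / t0 * (c z / C0) ^ (2 * e)"
        using C0 Q0 by (simp add: t0_def power_divide mult_ac)
      show "1 \<le> N" by (rule N)
      show "2 * e = 0 \<or> N \<le> 2 * e" using dense by (auto simp: e_def N_def)
      show "q z / Q0 = 0" if "c z / C0 = 0"
      proof -
        obtain B where B: "\<And>x. deg w x \<le> B" using weight_deg[OF w] by (rule weight_bound) auto
        have "q z \<le> (LINT x|M. ?W x * B)"
          unfolding q_def using B W w
          by (intro integral_mono test_fun_integrable test_fun_mult test_fun_const weight_test_fun
              weight_deg mult_left_mono weight_nonneg)
        also have "\<dots> = 0" using that C0 by (simp add: c_def)
        finally show ?thesis using \<open>0 \<le> q z / Q0\<close> Q0 by (simp add: zero_le_divide_iff)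
      qed
    qed
    \<comment> \<open>The tangent plane times the density of \<open>z\<close>, arranged so that its integral can be read off:
        its linear terms cancel because the tangency point consists of the means.\<close>
    let ?r = "\<lambda>z. (1 - real N) * om z + real (2 * e) / Q0 * (om z * q z)
      + (real N - real (2 * e)) / C0 * (om z * c z)"
    have "(LINT z|?PS. ?r z) = (1 - real N) * (LINT z|?PS. om z)
        + real (2 * e) / Q0 * (LINT z|?PS. om z * q z)
        + (real N - real (2 * e)) / C0 * (LINT z|?PS. om z * c z)"
      using int_om int_q int_c by simp
    then have "I ^ s = (LINT z|?PS. ?r z)"
      using C0 Q0 by (simp add: om_eq q_eq c_eq) (simp add: algebra_simps)
    also have "(LINT z|?PS. ?r z) \<le> (LINT z|?PS. P ^ e / t0 * (om z * U z))"
    proof (intro integral_mono)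
      fix z assume z: "z \<in> space ?PS"
      have "0 \<le> om z" unfolding om_def using w by (intro prod_nonneg) (simp add: weight_nonneg)
      from mult_left_mono[OF pointwise[OF z] this]
      show "?r z \<le> P ^ e / t0 * (om z * U z)" by (simp add: algebra_simps diff_divide_distrib)
    qed (use int_om int_q int_c int_U in auto)
    also have "\<dots> = P ^ e / t0 * T" by (simp add: T_eq)
    finally have main: "I ^ s * t0 \<le> P ^ e * T" using t0 by (simp add: field_simps)

    \<comment> \<open>It remains to bound the value \<open>t0\<close> at the point of tangency from below by powers of \<open>m\<close>.\<close>
    have "m \<le> Q0 / C0"
      using D_Suc[of s] D_pos[of s] I0 by (simp add: Q0_def C0_def field_simps)
    moreover have "m ^ s * I / I ^ s \<le> C0"
      unfolding C0_def using I0 by (intro divide_right_mono D_ge) auto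
    ultimately have "(m ^ s * I / I ^ s) ^ N * m ^ (2 * e) \<le> t0"
      unfolding t0_def using m I0 C0 by (intro mult_mono power_mono) auto
    then have "I ^ s * ((m ^ s * I / I ^ s) ^ N * m ^ (2 * e)) \<le> P ^ e * T"
      using main I0 by (meson mult_left_mono order_trans zero_le_power less_imp_le)
    moreover have "(m ^ s * I / I ^ s) ^ N = m ^ (N * s) * I ^ N / I ^ (N * s)"
      by (simp add: power_divide power_mult_distrib power_mult[symmetric] mult.commute)
    moreover have "m ^ (2 * e) = m ^ e * m ^ e"
      by (simp add: mult_2 power_add)
    moreover have "P ^ e = m ^ e * I ^ e"
      using I0 by (simp add: m_def power_divide)
    ultimately have "m ^ e * (I ^ s * (m ^ (N * s) * I ^ N / I ^ (N * s)) * m ^ e) \<le> m ^ e * (I ^ e * T)"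
      by (simp only: mult_ac)
    then have "I ^ s * (m ^ (N * s) * I ^ N / I ^ (N * s)) * m ^ e \<le> I ^ e * T"
      by (rule mult_left_le_imp_le) (use m in simp)
    then have "I ^ (N + s) * m ^ (e + N * s) \<le> T * I ^ (e + N * s)"
      using I0 by (simp add: power_add field_simps)
    from mult_right_mono[OF this, of "I ^ (e + N * s)"]
    have "I ^ (N + s) * (m * I) ^ (e + N * s) \<le> T * I ^ (e + N * s) * I ^ (e + N * s)"
      using I0 by (simp only: power_mult_distrib mult.assoc zero_le_power less_imp_le)
    also have "\<dots> = T * I ^ (2 * (e + N * s))"
      by (simp only: mult_2 power_add[of I "e + N * s"] mult.assoc)
    finally have "I ^ (N + s) * (m * I) ^ (e + N * s) \<le> T * I ^ (2 * (e + N * s))" .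
    then show ?thesis using I0 by (simp add: m_def)
  qed
  then show "(LINT x|M. w x) ^ card (V \<union> S) * form w w ^ card (E \<union> join_edges V S)
      \<le> weighted_density (V \<union> S) (E \<union> join_edges V S) w
        * (LINT x|M. w x) ^ (2 * card (E \<union> join_edges V S))"
    unfolding cardV cardE I_def P_def T_def .
qed

section \<open>Complements of matchings\<close>

lemma weighted_good_edgeless:
  assumes "finite V"
  shows "weighted_good V {}"
proof -
  interpret PM: product_prob_space "\<lambda>_. M" by unfold_locales
  have "weighted_density V {} w = (LINT x|M. w x) ^ card V" if "weight w" for w
    using PM.product_integral_prod[OF assms, of "\<lambda>_. w"] that
    by (simp add: weighted_density_def test_fun_integrable weight_test_fun)
  then show ?thesis by (simp add: weighted_good_def)
qed

text \<open>
  The vertex \<open>v\<close> together with its partner in the complement, if there is one, forms an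
  independent set \<open>S\<close> that is completely joined to the remaining vertices. The bound on the number
  of edges is carried through the induction because the join step requires it.
\<close>

lemma weighted_good_matching_complement:
  fixes V :: "'a set"
  assumes "finite V" "E \<subseteq> vertex_pairs V" "independent_edges (complement_edges V E)"
  shows "weighted_good V E \<and> (E = {} \<or> card V \<le> 2 * card E)"
  using assms
proof (induction "card V" arbitrary: V E rule: less_induct)
  case less
  show ?case
  proof (cases "V = {}")
    case True
    then have "E = {}" using less.prems by (auto simp: vertex_pairs_def)
    then show ?thesis using weighted_good_edgeless[OF less.prems(1)] by simp
  next
    case False
    then obtain v where v: "v \<in> V" by auto
    define S where "S = {u \<in> V. u = v \<or> {u, v} \<in> complement_edges V E}"
    have S: "v \<in> S" "S \<subseteq> V" "finite S" using v less.prems by (auto simp: S_def)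
    define V' where "V' = V - S"
    define E' where "E' = E \<inter> vertex_pairs V'"
    have disj: "V' \<inter> S = {}" "V = V' \<union> S" using S by (auto simp: V'_def)
    have indep: "a = b" if "a \<in> complement_edges V E" "b \<in> complement_edges V E" "x \<in> a" "x \<in> b"
      for a b x
      using that less.prems(3) by (auto simp: independent_edges_def pairwise_def disjnt_iff)
    have pair: "{x, y} \<in> E \<or> {x, y} \<in> complement_edges V E" if "x \<in> V" "y \<in> V" "x \<noteq> y" for x y
      using that by (auto simp: complement_edges_def vertex_pairs_def)
    have S_two: "x = y" if "x \<in> S" "y \<in> S" "x \<noteq> v" "y \<noteq> v" for x y
      using indep[of "{x, v}" "{y, v}" v] that by (auto simp: S_def doubleton_eq_iff)
    have inside: "{x, y} \<notin> E" if in_S: "x \<in> S" "y \<in> S" for x y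
    proof
      assume xy: "{x, y} \<in> E"
      then have "x \<noteq> y" using less.prems by (auto simp: vertex_pairs_def)
      then consider "x = v" "y \<noteq> v" | "y = v" "x \<noteq> v" using S_two[OF in_S] by blast
      then show False
        using xy in_S by cases (auto simp: S_def complement_edges_def insert_commute)
    qed
    have across: "{x, y} \<in> E" if "x \<in> V'" "y \<in> S" for x y
    proof (rule ccontr)
      assume "{x, y} \<notin> E"
      moreover have "x \<noteq> y" "x \<in> V" "y \<in> V" using that S by (auto simp: V'_def)
      ultimately have *: "{x, y} \<in> complement_edges V E" using pair by blast
      show False
      proof (cases "y = v")
        case True
        then show ?thesis using * that by (auto simp: V'_def S_def)
      next
        case False
        then have "{y, v} \<in> complement_edges V E" using that by (auto simp: S_def)
        then have "{x, y} = {y, v}" using indep[OF *] by blast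
        then have "x = v" using False by (auto simp: doubleton_eq_iff)
        then show ?thesis using that S by (auto simp: V'_def)
      qed
    qed
    have E_eq: "E = E' \<union> join_edges V' S"
    proof (intro equalityI subsetI)
      fix e assume e: "e \<in> E"
      then obtain x y where xy: "e = {x, y}" "x \<in> V" "y \<in> V"
        using less.prems by (auto simp: vertex_pairs_def card_2_iff subset_iff)
      have c2: "card e = 2" using e less.prems by (auto simp: vertex_pairs_def)
      consider "x \<in> V'" "y \<in> V'" | "x \<in> V'" "y \<in> S" | "y \<in> V'" "x \<in> S" | "x \<in> S" "y \<in> S"
        using xy disj by blast
      then show "e \<in> E' \<union> join_edges V' S"
      proof cases
        case 1
        then show ?thesis using e c2 xy by (auto simp: E'_def vertex_pairs_def)
      next
        case 4
        then show ?thesis using inside e xy by blast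
      qed (auto simp: join_edges_def xy insert_commute)
    next
      fix e assume "e \<in> E' \<union> join_edges V' S"
      then show "e \<in> E" using across by (auto simp: E'_def join_edges_def)
    qed
    have V': "card V' < card V" "finite V'" and E': "E' \<subseteq> vertex_pairs V'"
      using less.prems S v by (auto simp: V'_def E'_def intro!: psubset_card_mono)
    have "complement_edges V' E' \<subseteq> complement_edges V E"
      using vertex_pairs_mono[of V' V] by (auto simp: complement_edges_def E'_def V'_def)
    then have "independent_edges (complement_edges V' E')"
      using less.prems(3) pairwise_subset unfolding independent_edges_def by blast
    from less.hyps[OF V' E' this]
    have IH: "weighted_good V' E'" "E' = {} \<or> card V' \<le> 2 * card E'" by auto
    show ?thesis
    proof (cases "V' = {}")
      case True
      then have "E = {}" using E_eq E' by (auto simp: join_edges_def vertex_pairs_def)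
      then show ?thesis using weighted_good_edgeless[OF less.prems(1)] by simp
    next
      case False
      have "weighted_good V E"
        using weighted_good_join[OF V'(2) S(3) False _ disj(1) E' IH] S(1) disj(2) E_eq by auto
      moreover have "card V \<le> 2 * card E"
      proof -
        have "0 < card V'" "0 < card S" using False V' S by (auto simp: card_gt_0_iff)
        then have "card V' \<le> card V' * card S" "card S \<le> card V' * card S" by auto
        moreover have "card V' * card S \<le> card E"
          unfolding card_join_edges[OF disj(1), symmetric]
          using E_eq finite_subset[OF less.prems(2) finite_vertex_pairs[OF less.prems(1)]]
          by (intro card_mono) auto
        moreover have "card V = card V' + card S"
          using disj V' S card_Un_disjoint by metis
        ultimately show ?thesis by linarith
      qed
      ultimately show ?thesis by simp
    qed
  qed
qed

end

section \<open>Completions and product measures\<close>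

text \<open>
  This removes the completion from the definition of the graph density, whose integrand is in
  general measurable only for the completed measure.
\<close>

lemma integral_completion_AE_eq:
  fixes f f' :: "'b \<Rightarrow> real"
  assumes f': "f' \<in> borel_measurable N" and ae: "AE x in N. f x = f' x"
  shows "integral\<^sup>L (completion N) f = integral\<^sup>L N f'"
proof -
  have f'c: "f' \<in> borel_measurable (completion N)"
    using f' by (rule measurable_completion)
  have aec: "AE x in completion N. f x = f' x"
    using ae by (rule AE_completion)
  have "f \<in> borel_measurable (completion N)"
  proof (rule measurableI)
    fix A :: "real set" assume "A \<in> sets borel"
    with f'c have preimage: "f' -` A \<inter> space (completion N) \<in> sets (completion N)"
      by (rule measurable_sets)
    have "AE x in completion N. x \<in> f' -` A \<inter> space (completion N)
        \<longleftrightarrow> x \<in> f -` A \<inter> space (completion N)"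
      using aec by eventually_elim auto
    then show "f -` A \<inter> space (completion N) \<in> sets (completion N)"
      by (rule completion.in_sets_AE[OF _ preimage]) simp
  qed simp
  then have "integral\<^sup>L (completion N) f = integral\<^sup>L (completion N) f'"
    by (intro integral_cong_AE f'c aec)
  then show ?thesis using integral_completion[OF f'] by simp
qed

text \<open>
  Lebesgue measure on \<open>S\<close> is complete, so \<open>f\<close> inherits measurability from \<open>f'\<close>. This is applied to
  slices of Lebesgue measurable functions.
\<close>

lemma integral_lebesgue_on_AE_eq:
  fixes f f' :: "'b::euclidean_space \<Rightarrow> real"
  assumes S: "S \<in> sets borel" and f': "f' \<in> borel_measurable borel"
    and ae: "AE x in lebesgue_on S. f x = f' x"
  shows "(LINT x|lebesgue_on S. f x) = (LINT x|lebesgue_on S. f' x)"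
proof -
  have to_lborel: "(LINT x|lebesgue_on S. u x) = (LINT x|lborel. indicator S x *\<^sub>R f' x)"
    if "AE x in lebesgue_on S. u x = f' x" for u
  proof -
    have "AE x in lborel. indicator S x *\<^sub>R u x = indicator S x *\<^sub>R f' x"
      using that S by (simp add: AE_restrict_space_iff AE_completion_iff) (auto simp: indicator_def)
    then show ?thesis
      using S f' by (subst integral_restrict_space) (auto intro!: integral_completion_AE_eq)
  qed
  show ?thesis using to_lborel[OF ae] to_lborel[of f'] by simp
qed

text \<open>
  Two different coordinates of a product of probability spaces are distributed like the product
  of two factors, so null sets of the square pull back to null sets.
\<close>

lemma AE_PiM_pair:
  assumes M: "prob_space M" and uv: "u \<in> V" "v \<in> V" "u \<noteq> v" and V: "finite V"
    and ae: "AE p in M \<Otimes>\<^sub>M M. Q p"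
  shows "AE x in PiM V (\<lambda>_. M). Q (x u, x v)"
proof -
  interpret M: prob_space M by fact
  interpret PM: product_prob_space "\<lambda>_. M" by unfold_locales
  have pair_meas: "(\<lambda>x. (x u, x v)) \<in> PiM J (\<lambda>_. M) \<rightarrow>\<^sub>M M \<Otimes>\<^sub>M M" if "{u, v} \<subseteq> J" for J
    using that by (intro measurable_Pair measurable_component_singleton) auto
  have distr: "distr (PiM V (\<lambda>_. M)) (M \<Otimes>\<^sub>M M) (\<lambda>x. (x u, x v)) = M \<Otimes>\<^sub>M M"
  proof (rule measure_eqI)
    fix A assume "A \<in> sets (distr (PiM V (\<lambda>_. M)) (M \<Otimes>\<^sub>M M) (\<lambda>x. (x u, x v)))"
    then have A [measurable]: "A \<in> sets (M \<Otimes>\<^sub>M M)" by simp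
    have res: "(\<lambda>f. restrict f {u, v}) \<in> PiM V (\<lambda>_. M) \<rightarrow>\<^sub>M PiM {u, v} (\<lambda>_. M)"
      using uv by (intro measurable_restrict_subset) auto
    have "emeasure (distr (PiM V (\<lambda>_. M)) (M \<Otimes>\<^sub>M M) (\<lambda>x. (x u, x v))) A
        = (\<integral>\<^sup>+ p. indicator A p \<partial>distr (PiM V (\<lambda>_. M)) (M \<Otimes>\<^sub>M M) (\<lambda>x. (x u, x v)))"
      by simp
    also have "\<dots> = (\<integral>\<^sup>+ x. indicator A (x u, x v) \<partial>PiM V (\<lambda>_. M))"
      using uv by (intro nn_integral_distr pair_meas) auto
    also have "\<dots> = (\<integral>\<^sup>+ x. indicator A (restrict x {u, v} u, restrict x {u, v} v) \<partial>PiM V (\<lambda>_. M))"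
      by simp
    also have "\<dots> = (\<integral>\<^sup>+ x. indicator A (x u, x v)
        \<partial>distr (PiM V (\<lambda>_. M)) (PiM {u, v} (\<lambda>_. M)) (\<lambda>f. restrict f {u, v}))"
      by (rule nn_integral_distr[symmetric, OF res])
         (simp add: measurable_compose[OF pair_meas borel_measurable_indicator[OF A]])
    also have "\<dots> = (\<integral>\<^sup>+ x. indicator A (x u, x v) \<partial>PiM {u, v} (\<lambda>_. M))"
      using uv V by (subst PM.distr_restrict[symmetric]) auto
    also have "\<dots> = (\<integral>\<^sup>+ p. indicator A (fst p, snd p) \<partial>(M \<Otimes>\<^sub>M M))"
      using uv by (subst PM.product_nn_integral_pair) auto
    finally show "emeasure (distr (PiM V (\<lambda>_. M)) (M \<Otimes>\<^sub>M M) (\<lambda>x. (x u, x v))) A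
        = emeasure (M \<Otimes>\<^sub>M M) A"
      by simp
  qed simp
  have "AE p in distr (PiM V (\<lambda>_. M)) (M \<Otimes>\<^sub>M M) (\<lambda>x. (x u, x v)). Q p"
    unfolding distr by (rule ae)
  then show ?thesis by (rule AE_distrD[OF pair_meas, rotated]) (use uv in simp)
qed

lemma id_measurable_lebesgue_on: "(\<lambda>x. x) \<in> lebesgue_on S \<rightarrow>\<^sub>M borel"
  by (intro measurable_restrict_space1 measurable_completion) simp

text \<open>
  Lebesgue measure on the square and the product of Lebesgue measure on the interval with itself
  have different sigma-algebras. They are compared on the Borel sets, where both turn out to have
  the indicator of the square as density.
\<close>

lemma distr_lebesgue_on:
  fixes S :: "'b::euclidean_space set"
  assumes [measurable]: "S \<in> sets borel"
  shows "distr (lebesgue_on S) borel (\<lambda>x. x) = density lborel (indicator S)"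
proof (rule measure_eqI)
  fix A assume "A \<in> sets (distr (lebesgue_on S) borel (\<lambda>x. x))"
  then have [measurable]: "A \<in> sets borel" by simp
  have "emeasure (distr (lebesgue_on S) borel (\<lambda>x. x)) A = emeasure (lebesgue_on S) (A \<inter> S)"
    by (subst emeasure_distr) (auto simp: id_measurable_lebesgue_on)
  also have "\<dots> = emeasure lebesgue (A \<inter> S)"
    by (intro emeasure_restrict_space) auto
  also have "\<dots> = emeasure lborel (S \<inter> A)"
    by (simp add: Int_commute)
  also have "\<dots> = (\<integral>\<^sup>+ x. indicator S x * indicator A x \<partial>lborel)"
    by (subst indicator_inter_arith[symmetric]) simp
  also have "\<dots> = emeasure (density lborel (indicator S)) A"
    by (simp add: emeasure_density)
  finally show "emeasure (distr (lebesgue_on S) borel (\<lambda>x. x)) A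
      = emeasure (density lborel (indicator S)) A" .
qed simp

section \<open>Borel versions of kernels on the unit square\<close>

abbreviation (input) "unit_square \<equiv> {0..1::real} \<times> {0..1::real}"

lemma unit_square_borel: "unit_square \<in> sets borel"
  by (intro borel_closed closed_Times) auto

lemma prob_space_lebesgue01: "prob_space lebesgue01"
  by (rule prob_spaceI) (simp add: emeasure_restrict_space)

lemma id_measurable_square:
  "(\<lambda>p. p) \<in> lebesgue01 \<Otimes>\<^sub>M lebesgue01 \<rightarrow>\<^sub>M (borel :: (real \<times> real) measure)"
proof -
  have "(\<lambda>p. (fst p, snd p)) \<in> lebesgue01 \<Otimes>\<^sub>M lebesgue01 \<rightarrow>\<^sub>M borel \<Otimes>\<^sub>M borel"
    by (intro measurable_Pair measurable_compose[OF measurable_fst id_measurable_lebesgue_on]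
        measurable_compose[OF measurable_snd id_measurable_lebesgue_on])
  then show ?thesis by (simp add: borel_prod)
qed

lemma distr_lebesgue01_pair:
  "distr (lebesgue01 \<Otimes>\<^sub>M lebesgue01) borel (\<lambda>p. p) = density lborel (indicator unit_square)"
proof -
  interpret L: prob_space lebesgue01 by (rule prob_space_lebesgue01)
  let ?D = "distr lebesgue01 borel (\<lambda>x. x)"
  have D: "?D = density lborel (indicator {0..1})" by (rule distr_lebesgue_on) simp
  interpret D: prob_space ?D by (rule L.prob_space_distr) (rule id_measurable_lebesgue_on)
  have "distr (lebesgue01 \<Otimes>\<^sub>M lebesgue01) borel (\<lambda>p. p) = ?D \<Otimes>\<^sub>M ?D"
    by (subst pair_measure_distr)
       (auto simp: id_measurable_lebesgue_on borel_prod D.sigma_finite_measure_axioms id_def)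
  also have "\<dots> = density (lborel \<Otimes>\<^sub>M lborel) (\<lambda>(x, y). indicator {0..1} x * indicator {0..1} y)"
    unfolding D using D.sigma_finite_measure_axioms[unfolded D]
    by (intro pair_measure_density) (auto simp: lborel.sigma_finite_measure_axioms)
  also have "\<dots> = density lborel (indicator unit_square)"
  proof -
    have "(\<lambda>(x, y). indicator {0..1} x * indicator {0..1} y :: ennreal) = indicator unit_square"
      by (auto simp: indicator_def split_beta)
    then show ?thesis by (simp add: lborel_prod)
  qed
  finally show ?thesis .
qed

lemma AE_lebesgue01_squareD:
  assumes "AE p in lebesgue01_square. Q p"
  shows "AE p in lebesgue01 \<Otimes>\<^sub>M lebesgue01. Q p"
proof -
  have "AE p in lborel. p \<in> unit_square \<longrightarrow> Q p"
    using assms unit_square_borel by (simp add: AE_restrict_space_iff AE_completion_iff)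
  then have "AE p in density lborel (indicator unit_square). Q p"
    using unit_square_borel by (subst AE_density) (auto simp: indicator_def)
  then show ?thesis
    unfolding distr_lebesgue01_pair[symmetric] by (rule AE_distrD[OF id_measurable_square])
qed

lemma integral_lebesgue01_square:
  fixes f :: "real \<times> real \<Rightarrow> real"
  assumes f: "f \<in> borel_measurable borel"
  shows "(LINT p|lebesgue01_square. f p) = (LINT p|(lebesgue01 \<Otimes>\<^sub>M lebesgue01). f p)"
proof -
  have "(LINT p|lebesgue01_square. f p) = (LINT p|distr lebesgue01_square borel (\<lambda>p. p). f p)"
    by (rule integral_distr[symmetric, OF id_measurable_lebesgue_on f])
  also have "\<dots> = (LINT p|distr (lebesgue01 \<Otimes>\<^sub>M lebesgue01) borel (\<lambda>p. p). f p)"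
    unfolding distr_lebesgue01_pair by (subst distr_lebesgue_on) (auto simp: borel_prod[symmetric])
  also have "\<dots> = (LINT p|(lebesgue01 \<Otimes>\<^sub>M lebesgue01). f p)"
    by (rule integral_distr[OF id_measurable_square f])
  finally show ?thesis .
qed

text \<open>
  A Lebesgue measurable function agrees almost everywhere with a Borel measurable one, and
  truncating the latter restores the bound everywhere.
\<close>

lemma bounded_measurable_borel_version:
  assumes "bounded_measurable h"
  obtains h' B where "h' \<in> borel_measurable borel" "\<And>p. \<bar>h' p\<bar> \<le> B"
    "AE p in lebesgue01_square. h p = h' p"
proof -
  obtain B where B: "\<And>p. p \<in> unit_square \<Longrightarrow> \<bar>h p\<bar> \<le> B"
    using assms by (auto simp: bounded_measurable_def bounded_iff)
  have B0: "0 \<le> B" using B[of "(0, 0)"] by auto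
  have "(\<lambda>p. indicator unit_square p *\<^sub>R h p) \<in> borel_measurable lebesgue"
    using assms unit_square_borel unfolding bounded_measurable_def
    by (subst (asm) borel_measurable_restrict_space_iff) auto
  then obtain h0 where h0: "h0 \<in> borel_measurable lborel"
    and ae: "AE p in lborel. indicator unit_square p *\<^sub>R h p = h0 p"
    using completion_ex_borel_measurable_real by blast
  define h' where "h' p = max (- B) (min B (h0 p))" for p
  show thesis
  proof (rule that[of h' B])
    have [measurable]: "h0 \<in> borel_measurable borel" using h0 by simp
    show "h' \<in> borel_measurable borel" unfolding h'_def by measurable
    show "\<bar>h' p\<bar> \<le> B" for p using B0 by (auto simp: h'_def)
    have "AE p in lborel. p \<in> unit_square \<longrightarrow> h p = h' p"
      using ae
    proof eventually_elim
      case (elim p)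
      then show ?case using B[of p] by (auto simp: h'_def indicator_def)
    qed
    then show "AE p in lebesgue01_square. h p = h' p"
      using unit_square_borel by (simp add: AE_restrict_space_iff AE_completion_iff)
  qed
qed

lemma AE_pair_fst:
  assumes "prob_space M" "AE x in M. Q x"
  shows "AE p in M \<Otimes>\<^sub>M M. Q (fst p)"
proof -
  interpret prob_space M by fact
  have "AE x in distr (M \<Otimes>\<^sub>M M) M fst. Q x"
    unfolding distr_pair_fst by (rule assms(2))
  then show ?thesis by (rule AE_distrD[OF measurable_fst])
qed

lemma AE_pair_swap:
  assumes "sigma_finite_measure M" "AE p in M \<Otimes>\<^sub>M M. Q p"
  shows "AE p in M \<Otimes>\<^sub>M M. Q (snd p, fst p)"
proof -
  interpret pair_sigma_finite M M using assms(1) by (simp add: pair_sigma_finite_def)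
  have "AE p in distr (M \<Otimes>\<^sub>M M) (M \<Otimes>\<^sub>M M) (\<lambda>(x, y). (y, x)). Q p"
    using assms(2) by (subst distr_pair_swap[symmetric])
  then have "AE p in M \<Otimes>\<^sub>M M. Q (case p of (x, y) \<Rightarrow> (y, x))"
    by (rule AE_distrD[rotated]) simp
  then show ?thesis by (simp add: split_beta)
qed

text \<open>
  For a Gram kernel the quadratic form is the integral over \<open>z\<close> of the square of
  \<open>\<integral>f(x) h(x,z) dx\<close>.
\<close>

lemma gram_kernel_psd:
  fixes k h :: "real \<times> real \<Rightarrow> real" and f :: "real \<Rightarrow> real"
  assumes M: "prob_space (M :: real measure)"
    and [measurable]: "k \<in> borel_measurable (M \<Otimes>\<^sub>M M)" "h \<in> borel_measurable (M \<Otimes>\<^sub>M M)"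
      "f \<in> borel_measurable M"
    and h: "\<And>p. \<bar>h p\<bar> \<le> B" and f: "\<And>x. \<bar>f x\<bar> \<le> C"
    and gram: "AE p in M \<Otimes>\<^sub>M M. k p = (LINT z|M. h (fst p, z) * h (snd p, z))"
  shows "0 \<le> (LINT x|M. f x * (LINT y|M. k (x, y) * f y))"
proof -
  interpret M: prob_space M by fact
  interpret pair_prob_space M M by unfold_locales
  define F where "F x z = f x * h (x, z)" for x z
  have [measurable]: "case_prod F \<in> borel_measurable (M \<Otimes>\<^sub>M M)"
    unfolding F_def by measurable
  have C0: "0 \<le> C" using f[of 0] by linarith
  have F: "\<bar>F x z\<bar> \<le> C * B" for x z
    unfolding F_def abs_mult using f h C0 by (intro mult_mono) auto
  have F2: "\<bar>F x z * F y z'\<bar> \<le> (C * B) * (C * B)" for x y z z'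
    unfolding abs_mult using F[of x z] F[of y z'] by (intro mult_mono) auto
  define a where "a z = (LINT y|M. F y z)" for z
  have a: "\<bar>a z\<bar> \<le> C * B" for z
  proof (cases "integrable M (\<lambda>y. F y z)")
    case True
    have "\<bar>a z\<bar> \<le> (LINT y|M. \<bar>F y z\<bar>)"
      unfolding a_def using integral_norm_bound[of M "\<lambda>y. F y z"] by simp
    also have "\<dots> \<le> (LINT y|M. C * B)"
      using True F by (intro integral_mono) auto
    finally show ?thesis by (simp add: M.prob_space)
  next
    case False
    then show ?thesis using F[of 0 0] by (simp add: a_def not_integrable_integral_eq)
  qed
  have [measurable]: "a \<in> borel_measurable M" unfolding a_def by measurable
  have "(LINT x|M. f x * (LINT y|M. k (x, y) * f y)) = (LINT x|M. LINT y|M. f x * (k (x, y) * f y))"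
    by simp
  also have "\<dots> = (LINT x|M. LINT y|M. LINT z|M. F x z * F y z)"
  proof (intro integral_cong_AE)
    show "AE x in M. (LINT y|M. f x * (k (x, y) * f y)) = (LINT y|M. LINT z|M. F x z * F y z)"
      using AE_space AE_pair[OF gram]
    proof eventually_elim
      case (elim x)
      note [measurable] = elim(1)
      show ?case
      proof (rule integral_cong_AE)
        show "AE y in M. f x * (k (x, y) * f y) = (LINT z|M. F x z * F y z)"
          using elim(2)
        proof eventually_elim
          case (elim y)
          have "(LINT z|M. F x z * F y z) = (LINT z|M. (f x * f y) * (h (x, z) * h (y, z)))"
            by (simp add: F_def mult_ac)
          then show ?case using elim by simp
        qed
      qed measurable
    qed
  qed measurable
  also have "\<dots> = (LINT x|M. LINT z|M. F x z * a z)"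
  proof (rule Bochner_Integration.integral_cong[OF refl])
    fix x assume [measurable]: "x \<in> space M"
    have int: "integrable (M \<Otimes>\<^sub>M M) (\<lambda>(y, z). F x z * F y z)"
      by (rule P.integrable_const_bound[of _ "(C * B) * (C * B)"])
         (use F2 in \<open>auto intro!: AE_I2 simp: split_beta\<close>)
    have "(LINT y|M. LINT z|M. F x z * F y z) = (LINT z|M. LINT y|M. F x z * F y z)"
      using Fubini_integral[OF int] by simp
    then show "(LINT y|M. LINT z|M. F x z * F y z) = (LINT z|M. F x z * a z)"
      by (simp add: a_def)
  qed
  also have "\<dots> = (LINT z|M. LINT x|M. F x z * a z)"
  proof -
    have "\<bar>F x z * a z\<bar> \<le> (C * B) * (C * B)" for x z
      unfolding abs_mult using F[of x z] a[of z] by (intro mult_mono) auto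
    then have int: "integrable (M \<Otimes>\<^sub>M M) (\<lambda>(x, z). F x z * a z)"
      by (intro P.integrable_const_bound[of _ "(C * B) * (C * B)"])
         (auto intro!: AE_I2 simp: split_beta)
    show ?thesis using Fubini_integral[OF int] by simp
  qed
  also have "\<dots> = (LINT z|M. a z * a z)"
    by (simp add: a_def)
  also have "0 \<le> \<dots>" by simp
  finally show ?thesis by simp
qed

text \<open>
  The Borel version of \<open>g\<close> is made nonnegative and symmetric everywhere by averaging its absolute
  value over the reflection; almost everywhere this changes nothing. The factor \<open>h\<close> is replaced by
  a Borel version as well, so that all its slices are measurable.
\<close>

lemma doubly_nonnegative_kernel:
  assumes g: "doubly_nonnegative g"
  obtains k K where "psd_kernel lebesgue01 k K"
    "AE p in lebesgue01 \<Otimes>\<^sub>M lebesgue01. g p = k p"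
    "(LINT p|lebesgue01_square. g p) = (LINT p|(lebesgue01 \<Otimes>\<^sub>M lebesgue01). k p)"
proof -
  let ?M = "lebesgue01"
  interpret M: prob_space ?M by (rule prob_space_lebesgue01)
  interpret pair_prob_space ?M ?M by unfold_locales
  have bm: "bounded_measurable g"
    and nonneg: "\<And>x y. \<lbrakk>x \<in> {0..1}; y \<in> {0..1}\<rbrakk> \<Longrightarrow> 0 \<le> g (x, y)"
    and sym: "\<And>x y. \<lbrakk>x \<in> {0..1}; y \<in> {0..1}\<rbrakk> \<Longrightarrow> g (x, y) = g (y, x)"
    using g by (auto simp: doubly_nonnegative_def)
  obtain h where h: "bounded_measurable h"
    and gram: "AE p in lebesgue01_square. g p = (LINT z|?M. h (fst p, z) * h (snd p, z))"
    using g by (auto simp: doubly_nonnegative_def split_beta)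
  obtain g' B where g': "g' \<in> borel_measurable borel" "\<And>p. \<bar>g' p\<bar> \<le> B"
    "AE p in lebesgue01_square. g p = g' p"
    using bounded_measurable_borel_version[OF bm] by blast
  obtain h' C where h': "h' \<in> borel_measurable borel" "\<And>p. \<bar>h' p\<bar> \<le> C"
    "AE p in lebesgue01_square. h p = h' p"
    using bounded_measurable_borel_version[OF h] by blast
  have [measurable]: "g' \<in> borel_measurable (?M \<Otimes>\<^sub>M ?M)" "h' \<in> borel_measurable (?M \<Otimes>\<^sub>M ?M)"
    using measurable_compose[OF id_measurable_square g'(1)]
      measurable_compose[OF id_measurable_square h'(1)] by simp_all
  define k where "k p = (\<bar>g' p\<bar> + \<bar>g' (snd p, fst p)\<bar>) / 2" for p
  have k_meas [measurable]: "k \<in> borel_measurable (?M \<Otimes>\<^sub>M ?M)"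
    unfolding k_def by measurable
  have ae_g: "AE p in ?M \<Otimes>\<^sub>M ?M. g p = g' p"
    by (rule AE_lebesgue01_squareD[OF g'(3)])
  have ae_k: "AE p in ?M \<Otimes>\<^sub>M ?M. g p = k p"
    using ae_g AE_pair_swap[OF M.sigma_finite_measure_axioms ae_g] AE_space
  proof eventually_elim
    case (elim p)
    then have "0 \<le> g p" "g (snd p, fst p) = g p"
      using nonneg[of "fst p" "snd p"] sym[of "fst p" "snd p"] by (auto simp: space_pair_measure)
    with elim(1,2) show ?case by (simp add: k_def)
  qed
  have "AE x in ?M. AE z in ?M. h (x, z) = h' (x, z)"
    by (rule AE_pair[OF AE_lebesgue01_squareD[OF h'(3)]])
  then have ae_h: "AE p in ?M \<Otimes>\<^sub>M ?M. AE z in ?M. h (fst p, z) = h' (fst p, z)"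
    by (rule AE_pair_fst[OF prob_space_lebesgue01])
  have gram': "AE p in ?M \<Otimes>\<^sub>M ?M. k p = (LINT z|?M. h' (fst p, z) * h' (snd p, z))"
    using ae_k ae_h AE_pair_swap[OF M.sigma_finite_measure_axioms ae_h] AE_lebesgue01_squareD[OF gram]
  proof eventually_elim
    case (elim p)
    have "(LINT z|?M. h (fst p, z) * h (snd p, z)) = (LINT z|?M. h' (fst p, z) * h' (snd p, z))"
    proof (rule integral_lebesgue_on_AE_eq)
      show "AE z in ?M. h (fst p, z) * h (snd p, z) = h' (fst p, z) * h' (snd p, z)"
        using elim(2,3) by eventually_elim simp
      show "(\<lambda>z. h' (fst p, z) * h' (snd p, z)) \<in> borel_measurable borel"
        using h'(1) by measurable
    qed simp
    with elim show ?case by simp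
  qed
  show thesis
  proof (rule that[of k B])
    show "psd_kernel ?M k B"
    proof
      show "0 \<le> k p" and "k (x, y) = k (y, x)" for p x y by (simp_all add: k_def)
      show "k p \<le> B" for p
        using g'(2)[of p] g'(2)[of "(snd p, fst p)"] by (simp add: k_def)
      show "0 \<le> (LINT x|?M. f x * (LINT y|?M. k (x, y) * f y))"
        if "f \<in> borel_measurable ?M" "\<And>x. \<bar>f x\<bar> \<le> C" for f C
        by (rule gram_kernel_psd[OF prob_space_lebesgue01 _ _ that(1) h'(2) that(2) gram']) measurable
    qed (rule k_meas)
    show "AE p in ?M \<Otimes>\<^sub>M ?M. g p = k p" by (rule ae_k)
    have "(LINT p|lebesgue01_square. g p) = (LINT p|lebesgue01_square. g' p)"
      using bm g' measurable_compose[OF id_measurable_lebesgue_on g'(1)]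
      by (intro integral_cong_AE) (auto simp: bounded_measurable_def)
    also have "\<dots> = (LINT p|(?M \<Otimes>\<^sub>M ?M). g' p)"
      by (rule integral_lebesgue01_square[OF g'(1)])
    also have "\<dots> = (LINT p|(?M \<Otimes>\<^sub>M ?M). k p)"
      using ae_g ae_k by (intro integral_cong_AE) auto
    finally show "(LINT p|lebesgue01_square. g p) = (LINT p|(?M \<Otimes>\<^sub>M ?M). k p)" .
  qed
qed

section \<open>Densities of complements of matchings\<close>

text \<open>
  For the constant weight one all powers of the total mass disappear, because \<open>M\<close> is a
  probability measure.
\<close>

lemma (in psd_kernel) graph_density_ge:
  assumes "finite V" "E \<subseteq> vertex_pairs V" "independent_edges (complement_edges V E)"
  shows "(LINT p|(M \<Otimes>\<^sub>M M). k p) ^ card E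
    \<le> (LINT x|PiM V (\<lambda>_. M). (\<Prod>e\<in>E. edge_factor k x e))"
proof -
  have total: "(LINT x|M. 1::real) = 1" by (simp add: prob_space)
  interpret pair_prob_space M M by unfold_locales
  have one: "weight (\<lambda>_. 1)" by (simp add: weight_def test_fun_const)
  have "integrable (M \<Otimes>\<^sub>M M) k"
    by (rule P.integrable_const_bound[of _ K]) (auto intro!: AE_I2 kernel_abs_le)
  then have "form (\<lambda>_. 1) (\<lambda>_. 1) = (LINT p|(M \<Otimes>\<^sub>M M). k p)"
    by (simp add: form_def deg_def integral_fst')
  moreover have "(LINT x|M. 1) ^ card V * form (\<lambda>_. 1) (\<lambda>_. 1) ^ card E
      \<le> weighted_density V E (\<lambda>_. 1) * (LINT x|M. 1) ^ (2 * card E)"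
    using weighted_good_matching_complement[OF assms] one unfolding weighted_good_def by blast
  ultimately show ?thesis
    by (simp add: weighted_density_def total del: lebesgue_integral_const)
qed

lemma graph_density_AE_eq:
  assumes g: "doubly_nonnegative g" and k: "psd_kernel lebesgue01 k K"
    and ae: "AE p in lebesgue01 \<Otimes>\<^sub>M lebesgue01. g p = k p"
    and V: "finite V" and E: "E \<subseteq> vertex_pairs V"
  shows "graph_density V E g = (LINT x|PiM V (\<lambda>_. lebesgue01). (\<Prod>e\<in>E. edge_factor k x e))"
  unfolding graph_density_def
proof (rule integral_completion_AE_eq)
  interpret k: psd_kernel lebesgue01 k K by (rule k)
  show "(\<lambda>x. \<Prod>e\<in>E. edge_factor k x e) \<in> borel_measurable (PiM V (\<lambda>_. lebesgue01))"
    using E by (intro borel_measurable_prod k.edge_factor_measurable) auto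
  have "AE x in PiM V (\<lambda>_. lebesgue01). edge_factor g x e = edge_factor k x e" if "e \<in> E" for e
  proof -
    have e: "e \<in> vertex_pairs V" using that E by auto
    then obtain u v where uv: "e = {u, v}" "u \<in> V" "v \<in> V" "u \<noteq> v"
      by (auto simp: vertex_pairs_def card_2_iff)
    show ?thesis
      using AE_PiM_pair[OF prob_space_lebesgue01 uv(2-4) V ae] AE_space
    proof eventually_elim
      case (elim x)
      then have "x u \<in> {0..1}" "x v \<in> {0..1}" using uv by (auto simp: space_PiM)
      then have "g (x u, x v) = g (x v, x u)" using g by (auto simp: doubly_nonnegative_def)
      with elim show ?case
        by (simp add: uv(1) edge_factor_doubleton k.kernel_sym)
    qed
  qed
  then have "AE x in PiM V (\<lambda>_. lebesgue01). \<forall>e\<in>E. edge_factor g x e = edge_factor k x e"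
    using finite_subset[OF E finite_vertex_pairs[OF V]] by (intro AE_finite_allI) auto
  then show "AE x in PiM V (\<lambda>_. lebesgue01).
      (\<Prod>e\<in>E. edge_factor g x e) = (\<Prod>e\<in>E. edge_factor k x e)"
    by eventually_elim (auto intro: prod.cong)
qed

theorem corollary5p4:
  fixes V :: "'a set" and E :: "'a set set"
  assumes "finite_simple_graph V E"
    and "independent_edges (complement_edges V E)"
  shows "good_graph V E"
  unfolding good_graph_def
proof (intro allI impI)
  have VE: "finite V" "E \<subseteq> vertex_pairs V"
    using assms(1) by (auto simp: finite_simple_graph_def)
  fix g assume g: "doubly_nonnegative g"
  obtain k K where k: "psd_kernel lebesgue01 k K"
    and ae: "AE p in lebesgue01 \<Otimes>\<^sub>M lebesgue01. g p = k p"
    and int: "(LINT p|lebesgue01_square. g p) = (LINT p|(lebesgue01 \<Otimes>\<^sub>M lebesgue01). k p)"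
    using doubly_nonnegative_kernel[OF g] by blast
  show "(LINT p|lebesgue01_square. g p) ^ card E \<le> graph_density V E g"
    unfolding graph_density_AE_eq[OF g k ae VE] int
    by (rule psd_kernel.graph_density_ge[OF k VE assms(2)])
qed

end
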